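(* Consider all park layouts, all walks of a visitor in such a park, and all junctions of the park (layouts and walks as defined in the context). The largest possible number of times that a visitor can enter a single junction during her walk is $3$. That is, in every layout and every walk, each junction is entered at most three times, and there exist a layout, a walk in it, and a junction that is entered exactly three times during that walk.
   Context: A park layout is a subset of the Euclidean plane consisting of several (finitely many) trails which meet at junctions, where junctions are points of the plane and trails are simple arcs. Every trail has its two endpoints at two different junctions, and each junction is the endpoint of exactly three trails. Trails only intersect at junctions (in particular, trails only meet at endpoints). No two distinct trails have the same pair of endpoints. (Thus a layout is a finite simple 3-regular graph embedded in the plane without crossings.) A walk: the visitor begins at a junction and starts walking along a trail having that junction as an endpoint. At the end of that first trail, she enters a junction and turns left. At the next junction she turns right, and so on, alternating left and right turns at each junction. She does this until she gets back to the junction where she started, at which point the walk ends. Here, upon arriving at a junction $v$ along a trail $e$, turning left means continuing along the trail that follows $e$ in the clockwise cyclic order of the three trails around $v$, and turning right means continuing along the trail that follows $e$ in the counterclockwise cyclic order around $v$. A junction is entered each time the visitor arrives at it at the end of a trail in her walk. *)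

theory Defs
  imports "HOL-Analysis.Analysis"
begin

text \<open>The Euclidean plane is \<^typ>\<open>complex\<close>. A trail is the point set of a simple arc. Its endpoints do
  not depend on the parametrisation, and reversing the parametrisation shows that both ends occur
  as a \<^const>\<open>pathstart\<close>.\<close>

definition endpoints :: "complex set \<Rightarrow> complex set" where
  "endpoints e = {v. \<exists>\<gamma>. arc \<gamma> \<and> path_image \<gamma> = e \<and> pathstart \<gamma> = v}"

text \<open>In \<open>trails_arcs\<close> the two junctions are distinct because \<^const>\<open>arc\<close> includes injectivity.\<close>

locale park_layout =
  fixes J :: "complex set" and T :: "complex set set"
  assumes finite_trails: "finite T"
    and trails_arcs: "\<And>e. e \<in> T \<Longrightarrow>
      \<exists>\<gamma>. arc \<gamma> \<and> path_image \<gamma> = e \<and> pathstart \<gamma> \<in> J \<and> pathfinish \<gamma> \<in> J"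
    and three_trails: "\<And>v. v \<in> J \<Longrightarrow> card {e \<in> T. v \<in> endpoints e} = 3"
    and trails_meet: "\<And>e f. e \<in> T \<Longrightarrow> f \<in> T \<Longrightarrow> e \<noteq> f \<Longrightarrow>
      e \<inter> f \<subseteq> J \<inter> endpoints e \<inter> endpoints f"
    and no_parallel_trails: "\<And>e f. e \<in> T \<Longrightarrow> f \<in> T \<Longrightarrow> endpoints e = endpoints f \<Longrightarrow> e = f"

text \<open>Trails are merely continuous, so they need not have tangent directions at a junction. The
  cyclic order of three trails around \<open>v\<close> is read off from the points at which they first reach a
  small circle centred at \<open>v\<close>. As the trails meet only at \<open>v\<close> near \<open>v\<close>, that cyclic order is the
  same for every circle small enough for all three trails to reach it.\<close>

definition exit_point :: "complex \<Rightarrow> real \<Rightarrow> complex set \<Rightarrow> complex" where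
  "exit_point v r e = (THE p. \<exists>\<gamma> t. arc \<gamma> \<and> path_image \<gamma> = e \<and> pathstart \<gamma> = v \<and>
     t \<in> {0..1} \<and> \<gamma> t = p \<and> dist v p = r \<and> (\<forall>s\<in>{0..<t}. dist v (\<gamma> s) < r))"

text \<open>Going counterclockwise around the centre \<open>v\<close> from \<open>p\<close>, one meets \<open>q\<close> strictly before \<open>s\<close>,
  and both strictly before returning to \<open>p\<close>.\<close>

definition ccw_points :: "complex \<Rightarrow> complex \<Rightarrow> complex \<Rightarrow> complex \<Rightarrow> bool" where
  "ccw_points v p q s \<longleftrightarrow>
     0 < Arg2pi ((q - v) / (p - v)) \<and>
     Arg2pi ((q - v) / (p - v)) < Arg2pi ((s - v) / (p - v))"

definition ccw_trails ::
    "complex \<Rightarrow> complex set \<Rightarrow> complex set \<Rightarrow> complex set \<Rightarrow> bool" where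
  "ccw_trails v e f g \<longleftrightarrow>
     (\<forall>\<^sub>F r in at_right 0. ccw_points v (exit_point v r e) (exit_point v r f) (exit_point v r g))"

text \<open>On arriving at \<open>v\<close> along \<open>e\<close>, a right turn takes the trail that follows \<open>e\<close> counterclockwise,
  and a left turn the one that follows \<open>e\<close> clockwise, which is the last of the three when counted
  counterclockwise from \<open>e\<close>.\<close>

definition turn_right :: "complex set set \<Rightarrow> complex \<Rightarrow> complex set \<Rightarrow> complex set \<Rightarrow> bool" where
  "turn_right T v e f \<longleftrightarrow>
     (\<exists>g. {h \<in> T. v \<in> endpoints h} = {e, f, g} \<and> ccw_trails v e f g)"

definition turn_left :: "complex set set \<Rightarrow> complex \<Rightarrow> complex set \<Rightarrow> complex set \<Rightarrow> bool" where
  "turn_left T v e f \<longleftrightarrow>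
     (\<exists>g. {h \<in> T. v \<in> endpoints h} = {e, f, g} \<and> ccw_trails v e g f)"

text \<open>A walk visits the junctions \<open>vs ! 0, vs ! 1, \<dots>\<close>, going from \<open>vs ! i\<close> to \<open>vs ! Suc i\<close> along
  \<open>es ! i\<close>. It ends at the first return to \<open>vs ! 0\<close>.\<close>

definition park_walk ::
    "complex set \<Rightarrow> complex set set \<Rightarrow> complex list \<Rightarrow> complex set list \<Rightarrow> bool" where
  "park_walk J T vs es \<longleftrightarrow>
     es \<noteq> [] \<and> length vs = Suc (length es) \<and> vs ! 0 \<in> J \<and>
     (\<forall>i < length es. es ! i \<in> T \<and> endpoints (es ! i) = {vs ! i, vs ! Suc i}) \<and>
     (\<forall>i. Suc i < length es \<longrightarrow>
        (if even i then turn_left T (vs ! Suc i) (es ! i) (es ! Suc i)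
         else turn_right T (vs ! Suc i) (es ! i) (es ! Suc i))) \<and>
     vs ! length es = vs ! 0 \<and>
     (\<forall>i. 0 < i \<and> i < length es \<longrightarrow> vs ! i \<noteq> vs ! 0)"

text \<open>The starting position is not an entry, but the final return to it is.\<close>

definition entries :: "complex list \<Rightarrow> complex \<Rightarrow> nat" where
  "entries vs v = count_list (tl vs) v"

end

(* A state of a walk is a directed trail together with the direction of the next turn. Moving on
   to the next state is injective, and reversing a walk exchanges left and right turns, so the
   reversed walk also alternates. If a walk contained a state and later its reversal, the parts
   between them, read from both ends, would agree and meet in a trail equal to its own reversal,
   which is impossible. Hence each of the three corners (pairs of trails) at a junction is used at
   most once, which bounds the entries by three. *)

theory Submission
  imports Defs
begin

section \<open>Cyclic order and turns\<close>

text \<open>Division by 0 yields 0, and \<open>Arg2pi\<close> vanishes at 0 and at 1, so any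
  coincidence among the four points breaks one of the strict inequalities.\<close>

lemma ccw_points_distinct:
  assumes "ccw_points v p q s"
  shows "p \<noteq> v" "q \<noteq> v" "s \<noteq> v" "p \<noteq> q" "q \<noteq> s" "p \<noteq> s"
  using assms Arg2pi_eq_0[of 1] by (auto simp: ccw_points_def split: if_splits)

text \<open>With \<open>z\<close> and \<open>w\<close> the positions of \<open>q\<close> and
  \<open>s\<close> relative to \<open>p\<close>, the arguments of \<open>s\<close> and
  \<open>p\<close> seen from \<open>q\<close> are \<open>Arg2pi w - Arg2pi z\<close> and
  \<open>2 * pi - Arg2pi z\<close>. Their order is just \<open>Arg2pi w < 2 * pi\<close>.\<close>

lemma ccw_points_rotate:
  assumes "ccw_points v p q s"
  shows "ccw_points v q s p"
proof -
  note ne = ccw_points_distinct[OF assms]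
  define z w where "z = (q - v) / (p - v)" and "w = (s - v) / (p - v)"
  have a: "0 < Arg2pi z" "Arg2pi z < Arg2pi w"
    using assms by (auto simp: ccw_points_def z_def w_def)
  have nz: "z \<noteq> 0" "w \<noteq> 0" using ne by (auto simp: z_def w_def)
  have q: "(s - v) / (q - v) = w / z" "(p - v) / (q - v) = inverse z"
    using ne by (auto simp: z_def w_def)
  have d: "Arg2pi (w / z) = Arg2pi w - Arg2pi z"
    using Arg2pi_divide nz a by auto
  have "Arg2pi (inverse z) = 2 * pi - Arg2pi z"
    using Arg2pi_inverse[of z] Arg2pi_eq_0_pi[of z] a by auto
  with d a Arg2pi_lt_2pi[of w] show ?thesis
    by (auto simp: ccw_points_def q)
qed

lemma ccw_trails_rotate: "ccw_trails v e f g \<Longrightarrow> ccw_trails v f g e"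
  unfolding ccw_trails_def by (elim eventually_mono) (rule ccw_points_rotate)

text \<open>\<open>at_right 0\<close> is a proper filter, so both orders would hold at a common
  radius, where they compare the same two arguments in opposite directions.\<close>

lemma ccw_trails_asym:
  assumes "ccw_trails v e f g" "ccw_trails v e g f"
  shows False
proof -
  have "\<forall>\<^sub>F r::real in at_right 0. False"
    using assms unfolding ccw_trails_def
    by eventually_elim (auto simp: ccw_points_def)
  then show False by simp
qed

lemma ccw_trails_distinct:
  assumes "ccw_trails v e f g"
  shows "e \<noteq> f \<and> f \<noteq> g \<and> e \<noteq> g"
proof -
  have "\<forall>\<^sub>F r::real in at_right 0. e \<noteq> f \<and> f \<noteq> g \<and> e \<noteq> g"
    using assms unfolding ccw_trails_def
    by eventually_elim (auto dest: ccw_points_distinct)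
  then show ?thesis by simp
qed

text \<open>One flag for both directions, true for left, lets a single set of lemmas serve both; in
  a walk the flag at step \<open>i\<close> is \<open>even i\<close>.\<close>

definition turn :: "bool \<Rightarrow> complex set set \<Rightarrow> complex \<Rightarrow> complex set \<Rightarrow> complex set \<Rightarrow> bool" where
  "turn b T v e f \<longleftrightarrow> (if b then turn_left T v e f else turn_right T v e f)"

text \<open>Rotating the cyclic order \<open>e g f\<close> of a left turn gives
  \<open>f e g\<close>, which is the order required for a right turn from \<open>f\<close> to
  \<open>e\<close>.\<close>

lemma turn_reverse: "turn b T v e f \<longleftrightarrow> turn (\<not> b) T v f e"
proof -
  have "turn_left T v e f \<longleftrightarrow> turn_right T v f e" for e f
    unfolding turn_left_def turn_right_def
    by (metis ccw_trails_rotate insert_commute)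
  then show ?thesis by (simp add: turn_def)
qed

lemma turnE:
  assumes "turn b T v e f"
  obtains g where "{h \<in> T. v \<in> endpoints h} = {e, f, g}" "e \<noteq> f" "f \<noteq> g" "e \<noteq> g"
    and "if b then ccw_trails v e g f else ccw_trails v e f g"
proof -
  obtain g where "{h \<in> T. v \<in> endpoints h} = {e, f, g}"
    and c: "if b then ccw_trails v e g f else ccw_trails v e f g"
    using assms unfolding turn_def turn_left_def turn_right_def by meson
  moreover have "e \<noteq> f" "f \<noteq> g" "e \<noteq> g"
    using c ccw_trails_distinct by (metis (full_types))+
  ultimately show ?thesis using that by blast
qed

text \<open>Only three trails meet at \<open>v\<close>, so two different continuations would
  exchange roles with the third trail and force both cyclic orders at once.\<close>

lemma turn_unique:
  assumes "turn b T v e f" "turn b T v e f'"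
  shows "f = f'"
proof (rule ccontr)
  assume "f \<noteq> f'"
  obtain g where g: "{h \<in> T. v \<in> endpoints h} = {e, f, g}" "e \<noteq> f" "f \<noteq> g" "e \<noteq> g"
    "if b then ccw_trails v e g f else ccw_trails v e f g"
    using assms(1) by (rule turnE)
  obtain g' where g': "{h \<in> T. v \<in> endpoints h} = {e, f', g'}" "e \<noteq> f'" "f' \<noteq> g'" "e \<noteq> g'"
    "if b then ccw_trails v e g' f' else ccw_trails v e f' g'"
    using assms(2) by (rule turnE)
  have "{e, f, g} = {e, f', g'}" using g(1) g'(1) by simp
  then have "f \<in> {e, f', g'}" "f' \<in> {e, f, g}" by (metis insertCI)+
  then have "f = g'" "g = f'" using g(2) g'(2) \<open>f \<noteq> f'\<close> by auto
  with g(5) g'(5) show False using ccw_trails_asym by (cases b) auto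
qed

text \<open>The pair \<open>e\<close>, \<open>f\<close> determines the third trail, and the two
  flags demand opposite cyclic orders of the three.\<close>

lemma turn_parity:
  assumes "turn b T v e f" "turn b' T v e f"
  shows "b = b'"
proof (rule ccontr)
  assume "b \<noteq> b'"
  obtain g where g: "{h \<in> T. v \<in> endpoints h} = {e, f, g}" "e \<noteq> f" "f \<noteq> g" "e \<noteq> g"
    "if b then ccw_trails v e g f else ccw_trails v e f g"
    using assms(1) by (rule turnE)
  obtain g' where g': "{h \<in> T. v \<in> endpoints h} = {e, f, g'}" "e \<noteq> f" "f \<noteq> g'" "e \<noteq> g'"
    "if b' then ccw_trails v e g' f else ccw_trails v e f g'"
    using assms(2) by (rule turnE)
  have "{e, f, g} = {e, f, g'}" using g(1) g'(1) by simp
  then have "g = g'" using g(2-4) g'(2-4) by blast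
  with g(5) g'(5) \<open>b \<noteq> b'\<close> show False using ccw_trails_asym by (cases b) auto
qed

lemma turn_trails:
  assumes "turn b T v e f"
  shows "{e, f} \<subseteq> {h \<in> T. v \<in> endpoints h} \<and> e \<noteq> f"
  using assms unfolding turn_def turn_left_def turn_right_def
  by (auto split: if_splits dest: ccw_trails_distinct)

section \<open>Walks\<close>

lemma (in park_layout) two_endpoints:
  assumes "e \<in> T" "endpoints e = {u, v}"
  shows "u \<noteq> v"
proof -
  obtain \<gamma> where \<gamma>: "arc \<gamma>" "path_image \<gamma> = e"
    using trails_arcs[OF assms(1)] by auto
  have "pathstart \<gamma> \<in> endpoints e"
    using \<gamma> by (auto simp: endpoints_def)
  moreover have "pathfinish \<gamma> \<in> endpoints e"
    using \<gamma> arc_reversepath path_image_reversepath pathstart_reversepath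
    unfolding endpoints_def by blast
  ultimately show ?thesis
    using assms(2) arc_distinct_ends[OF \<gamma>(1)] by auto
qed

locale park_visit = park_layout +
  fixes vs es
  assumes walk: "park_walk J T vs es"
begin

lemma trail:
  assumes "i < length es"
  shows "es ! i \<in> T" "endpoints (es ! i) = {vs ! i, vs ! Suc i}" "vs ! i \<noteq> vs ! Suc i"
proof -
  show "es ! i \<in> T" "endpoints (es ! i) = {vs ! i, vs ! Suc i}"
    using walk assms by (auto simp: park_walk_def)
  then show "vs ! i \<noteq> vs ! Suc i" by (rule two_endpoints)
qed

lemma walk_turn:
  "Suc i < length es \<Longrightarrow> turn (even i) T (vs ! Suc i) (es ! i) (es ! Suc i)"
  using walk by (auto simp: park_walk_def turn_def)

lemma no_return: "0 < i \<Longrightarrow> i < length es \<Longrightarrow> vs ! i \<noteq> vs ! 0"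
  using walk by (auto simp: park_walk_def)

text \<open>Reading forward from \<open>i\<close> and backward from \<open>j\<close>, the turns
  carry the same flag, because reversal flips the flag and so does moving back by one index. The two
  readings therefore agree, and the reversed pair moves inward until it sits at a single
  index.\<close>

lemma no_reversed_state:
  assumes "i \<le> j" "j < length es" "even i = even j"
    and "es ! i = es ! j" "vs ! i = vs ! Suc j" "vs ! Suc i = vs ! j"
  shows False
  using assms
proof (induction "j - i" arbitrary: i j rule: less_induct)
  case less
  show False
  proof (cases "i = j")
    case True
    then show False using less.prems trail(3) by metis
  next
    case False
    then obtain k where k: "j = Suc k" "i \<le> k" "even (Suc i) = even k"
      using less.prems(1,3) by (cases j) auto
    \<comment> \<open>Equal parity of \<open>i\<close> and \<open>j\<close> excludes adjacent
      positions, so the two readings cannot pass each other without meeting.\<close>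
    then have "i \<noteq> k" by auto
    with k(2) have ik: "Suc i \<le> k" by simp
    have "turn (even k) T (vs ! j) (es ! k) (es ! j)"
      using walk_turn[of k] less.prems k by auto
    then have "turn (even j) T (vs ! j) (es ! j) (es ! k)"
      using turn_reverse k by simp
    moreover have "turn (even j) T (vs ! j) (es ! j) (es ! Suc i)"
      using walk_turn[of i] less.prems k ik by auto
    ultimately have e: "es ! Suc i = es ! k" by (rule turn_unique[symmetric])
    have "{vs ! Suc i, vs ! Suc (Suc i)} = {vs ! k, vs ! Suc k}"
      using e trail(2)[of "Suc i"] trail(2)[of k] less.prems k ik by auto
    then have "vs ! Suc (Suc i) = vs ! k"
      using less.prems(6) k by (auto simp: doubleton_eq_iff)
    moreover have "k - Suc i < j - i" using k(1) ik by linarith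
    ultimately show False
      using less.hyps[of k "Suc i"] e k ik less.prems by auto
  qed
qed

text \<open>Backward turns are unique as well, so a repetition can be pushed back one step at a time
  until its earlier copy is the initial state. The later copy is then a premature return to the
  start.\<close>

lemma no_repeated_state:
  assumes "i < j" "j < length es" "even i = even j"
    and "es ! i = es ! j" "vs ! i = vs ! j"
  shows False
  using assms
proof (induction i arbitrary: j)
  case 0
  then show False using no_return[of j] by auto
next
  case (Suc i)
  then obtain k where k: "j = Suc k" "i < k" by (cases j) auto
  have "turn (even j) T (vs ! j) (es ! j) (es ! k)"
    using walk_turn[of k] Suc.prems k turn_reverse by simp
  moreover have "turn (even j) T (vs ! j) (es ! j) (es ! i)"
    using walk_turn[of i] Suc.prems k turn_reverse by simp
  ultimately have e: "es ! i = es ! k" by (rule turn_unique[symmetric])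
  have "{vs ! i, vs ! Suc i} = {vs ! k, vs ! Suc k}"
    using e trail(2)[of i] trail(2)[of k] Suc.prems k by auto
  then have "vs ! i = vs ! k"
    using Suc.prems(5) k by (auto simp: doubleton_eq_iff)
  then show False using Suc.IH[of k] e k Suc.prems by auto
qed

section \<open>Counting entries by corners\<close>

lemma entries_card: "entries vs v = card {i. i < length es \<and> vs ! Suc i = v}"
proof -
  have len: "length vs = Suc (length es)" using walk by (auto simp: park_walk_def)
  then have "{i. i < length (tl vs) \<and> v = tl vs ! i} = {i. i < length es \<and> vs ! Suc i = v}"
    by (auto simp: nth_tl)
  then show ?thesis
    by (simp add: entries_def count_list_eq_length_filter length_filter_conv_card)
qed

text \<open>At \<open>v\<close> there are three corners, i.e. unordered pairs of trails. Using a corner twice would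
  repeat a state (trail, direction, next turn) of the walk or produce the reversal of an earlier
  one.\<close>

lemma corners_inj:
  assumes "v \<noteq> vs ! 0"
  shows "inj_on (\<lambda>i. {es ! i, es ! Suc i}) {i. i < length es \<and> vs ! Suc i = v}"
proof -
  have last: "vs ! length es = vs ! 0" using walk by (auto simp: park_walk_def)
  have *: False if ij: "i < j" "j < length es" "vs ! Suc i = v" "vs ! Suc j = v"
    and eq: "{es ! i, es ! Suc i} = {es ! j, es ! Suc j}" for i j
  proof -
    \<comment> \<open>The last arrival is at \<open>vs ! 0\<close>, so an arrival at any other
      junction is followed by a further trail.\<close>
    have lt: "Suc j < length es"
      using ij assms last by (metis Suc_lessI)
    have ti: "turn (even i) T v (es ! i) (es ! Suc i)"
      and tj: "turn (even j) T v (es ! j) (es ! Suc j)"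
      using walk_turn[of i] walk_turn[of j] lt ij by auto
    consider "es ! i = es ! j" "es ! Suc i = es ! Suc j"
      | "es ! i = es ! Suc j" "es ! Suc i = es ! j"
      using eq by (auto simp: doubleton_eq_iff)
    then show False
    proof cases
      case 1
      then have "even i = even j" using turn_parity ti tj by metis
      moreover have "vs ! i = vs ! j"
        using trail(2)[of i] trail(2)[of j] 1 ij by (auto simp: doubleton_eq_iff)
      ultimately show False using no_repeated_state ij 1 by blast
    next
      case 2
      \<comment> \<open>The corner is crossed in opposite directions. Reversing the second crossing
        shows that the trail at \<open>Suc j\<close> is the reversal of the state at
        \<open>i\<close>, with matching parity.\<close>
      then have "turn (\<not> even j) T v (es ! i) (es ! Suc i)"
        using turn_reverse tj by metis
      then have "even i = even (Suc j)" using turn_parity ti by fastforce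
      moreover have "vs ! i = vs ! Suc (Suc j)"
        using trail(2)[of i] trail(2)[of "Suc j"] 2 ij lt by (auto simp: doubleton_eq_iff)
      ultimately show False
        using no_reversed_state[of i "Suc j"] 2 ij lt by simp
    qed
  qed
  show ?thesis
  proof (rule inj_onI)
    fix i j
    assume "i \<in> {i. i < length es \<and> vs ! Suc i = v}" "j \<in> {i. i < length es \<and> vs ! Suc i = v}"
      and "{es ! i, es ! Suc i} = {es ! j, es ! Suc j}"
    then show "i = j" using *[of i j] *[of j i] by (cases i j rule: linorder_cases) auto
  qed
qed

lemma entries_le:
  assumes "v \<in> J"
  shows "entries vs v \<le> 3"
proof (cases "v = vs ! 0")
  case True
  \<comment> \<open>The starting junction is entered only by the return that ends the walk.\<close>
  have "{i. i < length es \<and> vs ! Suc i = v} \<subseteq> {length es - 1}"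
  proof
    fix i assume "i \<in> {i. i < length es \<and> vs ! Suc i = v}"
    then have "i < length es" "\<not> Suc i < length es"
      using no_return[of "Suc i"] True by auto
    then show "i \<in> {length es - 1}" by simp
  qed
  from card_mono[OF _ this] show ?thesis by (simp add: entries_card)
next
  case False
  let ?I = "{i. i < length es \<and> vs ! Suc i = v}" and ?S = "{h \<in> T. v \<in> endpoints h}"
  have last: "vs ! length es = vs ! 0" using walk by (auto simp: park_walk_def)
  have "(\<lambda>i. {es ! i, es ! Suc i}) ` ?I \<subseteq> {X. X \<subseteq> ?S \<and> card X = 2}"
  proof (rule image_subsetI)
    fix i assume "i \<in> ?I"
    then have i: "i < length es" "vs ! Suc i = v" by auto
    then have "Suc i < length es" using False last by (metis Suc_lessI)
    from turn_trails[OF walk_turn[OF this]] i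
    show "{es ! i, es ! Suc i} \<in> {X. X \<subseteq> ?S \<and> card X = 2}" by auto
  qed
  then have "card ?I \<le> card {X. X \<subseteq> ?S \<and> card X = 2}"
    using card_inj_on_le[OF corners_inj[OF False]] finite_trails by auto
  also have "\<dots> = 3"
    using n_subsets[of ?S 2] three_trails[OF assms] finite_trails
    by (simp add: numeral_3_eq_3 choose_two)
  finally show ?thesis by (simp add: entries_card)
qed

end

section \<open>Straight-line layouts\<close>

text \<open>Removing its start point leaves an arc connected, whereas removing an interior point
  disconnects a segment.\<close>

lemma endpoints_closed_segment:
  assumes "a \<noteq> b"
  shows "endpoints (closed_segment a b) = {a, b}"
proof
  have "a \<in> endpoints (closed_segment a b)" if "a \<noteq> b" for a b :: complex
    unfolding endpoints_def using that by (auto intro!: exI[of _ "linepath a b"])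
  from this[of a b] this[of b a] assms
  show "{a, b} \<subseteq> endpoints (closed_segment a b)"
    by (simp add: closed_segment_commute)
next
  show "endpoints (closed_segment a b) \<subseteq> {a, b}"
  proof
    fix v assume "v \<in> endpoints (closed_segment a b)"
    then obtain \<gamma> where \<gamma>: "arc \<gamma>" "path_image \<gamma> = closed_segment a b" "\<gamma> 0 = v"
      by (auto simp: endpoints_def pathstart_def)
    show "v \<in> {a, b}"
    proof (rule ccontr)
      assume v: "v \<notin> {a, b}"
      have inj: "inj_on \<gamma> {0..1}" and cont: "continuous_on {0..1} \<gamma>"
        using \<gamma>(1) by (auto simp: arc_def path_def)
      define C where "C = \<gamma> ` {0<..1}"
      have "{0..1::real} = insert 0 {0<..1}" by auto
      then have im: "closed_segment a b = insert v C"
        using \<gamma> by (metis C_def image_insert path_image_def)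
      have "v \<notin> C"
      proof
        assume "v \<in> C"
        then obtain x where "0 < x" "x \<le> 1" "\<gamma> 0 = \<gamma> x" using \<gamma>(3) by (auto simp: C_def)
        then show False using inj_onD[OF inj, of 0 x] by simp
      qed
      have "connected C"
        unfolding C_def
        by (intro connected_continuous_image continuous_on_subset[OF cont]) auto
      obtain u where u: "v = a + u *\<^sub>R (b - a)" "0 \<le> u" "u \<le> 1"
        using im by (auto simp: closed_segment_def algebra_simps)
      have d: "0 < (b - a) \<bullet> (b - a)" using assms by simp
      have "a \<in> C" "b \<in> C" using im v by auto
      moreover have "(b - a) \<bullet> a \<le> (b - a) \<bullet> v" "(b - a) \<bullet> v \<le> (b - a) \<bullet> b"
      proof -
        have "(b - a) \<bullet> v = (b - a) \<bullet> a + u * ((b - a) \<bullet> (b - a))"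
          by (simp add: u inner_right_distrib)
        moreover have "(b - a) \<bullet> b = (b - a) \<bullet> a + (b - a) \<bullet> (b - a)"
          by (simp add: inner_diff_right)
        ultimately show "(b - a) \<bullet> a \<le> (b - a) \<bullet> v" "(b - a) \<bullet> v \<le> (b - a) \<bullet> b"
          using u d by (auto intro: mult_left_le_one_le)
      qed
      \<comment> \<open>The connected set \<open>C\<close> contains both \<open>a\<close> and
        \<open>b\<close>, so it meets the perpendicular to the segment through \<open>v\<close>;
        that perpendicular meets the segment only in \<open>v\<close>.\<close>
      ultimately obtain z where z: "z \<in> C" "(b - a) \<bullet> z = (b - a) \<bullet> v"
        using connected_ivt_hyperplane[OF \<open>connected C\<close>] by blast
      obtain w where w: "z = a + w *\<^sub>R (b - a)"
        using im z(1) by (auto simp: closed_segment_def algebra_simps)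
      have "w = u" using z(2) d by (simp add: u w inner_right_distrib)
      then have "z = v" by (simp add: u w)
      then show False using z(1) \<open>v \<notin> C\<close> by simp
    qed
  qed
qed

text \<open>The segment has just one point at distance \<open>r\<close> from \<open>v\<close>, so
  every admissible parametrisation yields the same point, and \<open>linepath\<close> supplies
  one.\<close>

lemma exit_point_closed_segment:
  assumes "0 < r" "r \<le> dist v w"
  shows "exit_point v r (closed_segment v w) = v + of_real (r / dist v w) * (w - v)"
proof -
  let ?p = "v + of_real (r / dist v w) * (w - v)"
  have d: "0 < dist v w" using assms by linarith
  have dist: "dist v (v + of_real s * (w - v)) = s * dist v w" if "0 \<le> s" for s
    using that by (simp add: dist_norm norm_mult norm_minus_commute)
  show ?thesis
    unfolding exit_point_def
  proof (rule the_equality)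
    let ?t = "r / dist v w"
    have lp: "linepath v w s = v + of_real s * (w - v)" for s
      by (simp add: linepath_def scaleR_conv_of_real algebra_simps)
    show "\<exists>\<gamma> t. arc \<gamma> \<and> path_image \<gamma> = closed_segment v w \<and> pathstart \<gamma> = v \<and>
        t \<in> {0..1} \<and> \<gamma> t = ?p \<and> dist v ?p = r \<and> (\<forall>s\<in>{0..<t}. dist v (\<gamma> s) < r)"
    proof (intro exI conjI)
      show "arc (linepath v w)" using d by (intro arc_linepath) auto
      show "?t \<in> {0..1}" using assms d by simp
      show "linepath v w ?t = ?p" by (rule lp)
      show "dist v ?p = r" using dist[of ?t] assms d by simp
      show "\<forall>s\<in>{0..<?t}. dist v (linepath v w s) < r"
        using dist d by (auto simp: lp field_simps)
    qed simp_all
  next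
    fix p
    assume "\<exists>\<gamma> t. arc \<gamma> \<and> path_image \<gamma> = closed_segment v w \<and> pathstart \<gamma> = v \<and>
        t \<in> {0..1} \<and> \<gamma> t = p \<and> dist v p = r \<and> (\<forall>s\<in>{0..<t}. dist v (\<gamma> s) < r)"
    then have "p \<in> closed_segment v w" and r: "dist v p = r"
      by (auto simp: path_image_def)
    then obtain s where s: "0 \<le> s" "p = v + of_real s * (w - v)"
      by (auto simp: closed_segment_def scaleR_conv_of_real algebra_simps)
    have "s * dist v w = r" using dist[OF s(1)] r by (simp only: s(2))
    then have "s = r / dist v w" using d by (simp add: field_simps)
    then show "p = ?p" by (simp add: s(2))
  qed
qed

text \<open>Once \<open>r\<close> is below all three lengths, the exit points are positive multiples
  of the directions to \<open>p\<close>, \<open>q\<close> and \<open>s\<close>, and positive factors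
  leave the arguments of quotients unchanged.\<close>

lemma ccw_trails_closed_segments:
  assumes "ccw_points v p q s"
  shows "ccw_trails v (closed_segment v p) (closed_segment v q) (closed_segment v s)"
proof -
  note ne = ccw_points_distinct[OF assms]
  have "\<forall>\<^sub>F r in at_right 0. r < d" if "0 < d" for d :: real
    using eventually_at_right_real[OF that] by (rule eventually_mono) simp
  then have "\<forall>\<^sub>F r in at_right 0. 0 < r \<and> r < dist v p \<and> r < dist v q \<and> r < dist v s"
    using ne(1-3) by (intro eventually_conj eventually_at_right_less) (simp_all add: dist_commute)
  then show ?thesis
    unfolding ccw_trails_def
  proof eventually_elim
    case (elim r)
    have "Arg2pi (of_real a * x / (of_real b * y)) = Arg2pi (x / y)" if "0 < a" "0 < b" for a b x y
      using Arg2pi_times_of_real[of "a / b" "x / y"] that by simp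
    with elim assms ne show ?case
      by (simp add: exit_point_closed_segment ccw_points_def del: of_real_divide)
  qed
qed

section \<open>Orientation tests on integer points\<close>

text \<open>Twice the signed area of the triangle \<open>abc\<close>.\<close>

fun cross :: "int \<times> int \<Rightarrow> int \<times> int \<Rightarrow> int \<times> int \<Rightarrow> int" where
  "cross (a1, a2) (b1, b2) (c1, c2) = (b1 - a1) * (c2 - a2) - (b2 - a2) * (c1 - a1)"

fun pt :: "int \<times> int \<Rightarrow> complex" where
  "pt (x, y) = Complex (of_int x) (of_int y)"

fun seg :: "(int \<times> int) \<times> (int \<times> int) \<Rightarrow> complex set" where
  "seg (a, b) = closed_segment (pt a) (pt b)"

lemma pt_inject [simp]: "pt a = pt b \<longleftrightarrow> a = b"
  by (cases a; cases b) auto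

lemma seg_commute: "seg (a, b) = seg (b, a)"
  by (simp add: closed_segment_commute)

declare seg.simps [simp del]

lemma endpoints_seg: "a \<noteq> b \<Longrightarrow> endpoints (seg (a, b)) = {pt a, pt b}"
  by (simp add: seg.simps endpoints_closed_segment)

text \<open>Of the three angles between directions in cyclic order, at least two are below \<open>\<pi>\<close>.\<close>

definition ccw_int :: "int \<times> int \<Rightarrow> int \<times> int \<Rightarrow> int \<times> int \<Rightarrow> int \<times> int \<Rightarrow> bool" where
  "ccw_int v p q s \<longleftrightarrow> 0 < cross v p q \<and> 0 < cross v q s \<or> 0 < cross v q s \<and> 0 < cross v s p
     \<or> 0 < cross v s p \<and> 0 < cross v p q"

text \<open>This imaginary part is \<open>cross v p q\<close> over the squared distance from
  \<open>v\<close> to \<open>p\<close>; its sign tells whether the angle from \<open>p\<close> to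
  \<open>q\<close> lies strictly between 0 and \<open>pi\<close>.\<close>

lemma Im_quotient:
  assumes "0 < cross v p q"
  shows "0 < Im ((pt q - pt v) / (pt p - pt v))"
proof -
  have "p \<noteq> v" using assms by (cases p; cases q) auto
  then have "pt p - pt v \<noteq> 0" by simp
  then have "0 < (Re (pt p - pt v))\<^sup>2 + (Im (pt p - pt v))\<^sup>2"
    by (simp only: complex_neq_0)
  moreover have "0 < Im (pt q - pt v) * Re (pt p - pt v) - Re (pt q - pt v) * Im (pt p - pt v)"
  proof -
    have "0 < real_of_int (cross v p q)" using assms by simp
    then show ?thesis by (cases v; cases p; cases q) (simp add: algebra_simps)
  qed
  ultimately show ?thesis by (simp only: Im_divide zero_less_divide_iff simp_thms)
qed

text \<open>Two angles below \<open>pi\<close> add up without wrapping around, so \<open>s\<close>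
  is seen from \<open>p\<close> at the sum of both angles, beyond \<open>q\<close>.\<close>

lemma ccw_pointsI:
  assumes "0 < cross v p q" "0 < cross v q s"
  shows "ccw_points (pt v) (pt p) (pt q) (pt s)"
proof -
  let ?z = "(pt q - pt v) / (pt p - pt v)" and ?w = "(pt s - pt v) / (pt q - pt v)"
  have 1: "0 < Arg2pi ?z" "Arg2pi ?z < pi" "0 < Arg2pi ?w" "Arg2pi ?w < pi"
    using Im_quotient[OF assms(1)] Im_quotient[OF assms(2)] Arg2pi_lt_pi by blast+
  then have "?z \<noteq> 0" "?w \<noteq> 0" by (metis Arg2pi_0 less_irrefl)+
  then have "Arg2pi (?z * ?w) = Arg2pi ?z + Arg2pi ?w"
    using Arg2pi_times[of ?z ?w] 1 by simp
  moreover have "?z * ?w = (pt s - pt v) / (pt p - pt v)"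
    using \<open>?z \<noteq> 0\<close> by (metis div_0 nonzero_eq_divide_eq times_divide_eq_left mult.commute)
  ultimately show ?thesis using 1 by (simp add: ccw_points_def)
qed

lemma ccw_int_points:
  "ccw_int v p q s \<Longrightarrow> ccw_points (pt v) (pt p) (pt q) (pt s)"
  unfolding ccw_int_def by (metis ccw_pointsI ccw_points_rotate)

text \<open>The second segment lies on one side of the line through the first one, and meets that line at
  most in a common endpoint.\<close>

definition one_side :: "(int \<times> int) \<times> (int \<times> int) \<Rightarrow> (int \<times> int) \<times> (int \<times> int) \<Rightarrow> bool" where
  "one_side e f = (case (e, f) of ((a, b), (c, d)) \<Rightarrow>
     0 < cross a b c * cross a b d \<or>
     cross a b c = 0 \<and> cross a b d \<noteq> 0 \<and> c \<in> {a, b} \<or>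
     cross a b d = 0 \<and> cross a b c \<noteq> 0 \<and> d \<in> {a, b})"

lemma one_side_inter:
  assumes "one_side (a, b) (c, d)"
  shows "seg (a, b) \<inter> seg (c, d) \<subseteq> {pt a, pt b} \<inter> {pt c, pt d}"
proof
  fix x assume x: "x \<in> seg (a, b) \<inter> seg (c, d)"
  obtain a1 a2 b1 b2 c1 c2 d1 d2
    where pairs: "a = (a1, a2)" "b = (b1, b2)" "c = (c1, c2)" "d = (d1, d2)"
    by (cases a; cases b; cases c; cases d) auto
  define f where "f y = (b1 - a1) * (Im y - a2) - (b2 - a2) * (Re y - a1)" for y
  obtain s where s: "x = (1 - s) *\<^sub>R pt a + s *\<^sub>R pt b"
    using x by (auto simp: seg.simps closed_segment_def)
  \<comment> \<open>\<open>f\<close> is the real extension of \<open>cross a b\<close>: it vanishes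
    on the line through \<open>a\<close> and \<open>b\<close>, and along the other segment it
    interpolates linearly between its values at \<open>c\<close> and \<open>d\<close>.\<close>
  have "f x = 0" by (simp add: f_def s pairs algebra_simps)
  obtain t where t: "0 \<le> t" "t \<le> 1" "x = (1 - t) *\<^sub>R pt c + t *\<^sub>R pt d"
    using x by (auto simp: seg.simps closed_segment_def)
  have "f x = (1 - t) * cross a b c + t * cross a b d"
    by (simp add: f_def t pairs algebra_simps)
  with \<open>f x = 0\<close> have eq: "(1 - t) * cross a b c + t * cross a b d = 0" by simp
  have "\<not> 0 < cross a b c * cross a b d"
  proof
    assume "0 < cross a b c * cross a b d"
    then consider "0 < cross a b c" "0 < cross a b d" | "cross a b c < 0" "cross a b d < 0"
      by (auto simp: zero_less_mult_iff)
    then show False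
    proof cases
      case 1
      then have "0 \<le> (1 - t) * cross a b c" "0 \<le> t * cross a b d" using t by simp_all
      with eq have "(1 - t) * cross a b c = 0" "t * cross a b d = 0" by linarith+
      then show False using 1 by auto
    next
      case 2
      then have "(1 - t) * cross a b c \<le> 0" "t * cross a b d \<le> 0"
        using t by (simp_all add: mult_nonneg_nonpos)
      with eq have "(1 - t) * cross a b c = 0" "t * cross a b d = 0" by linarith+
      then show False using 2 by auto
    qed
  qed
  then consider "cross a b c = 0" "cross a b d \<noteq> 0" "c \<in> {a, b}"
    | "cross a b d = 0" "cross a b c \<noteq> 0" "d \<in> {a, b}"
    using assms by (auto simp: one_side_def)
  then show "x \<in> {pt a, pt b} \<inter> {pt c, pt d}"
  proof cases
    case 1
    then have "t = 0" using eq by auto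
    then show ?thesis using 1(3) t(3) by auto
  next
    case 2
    then have "t = 1" using eq by auto
    then show ?thesis using 2(3) t(3) by auto
  qed
qed

section \<open>Layouts from finite edge lists\<close>

definition nbrs :: "((int \<times> int) \<times> (int \<times> int)) list \<Rightarrow> int \<times> int \<Rightarrow> (int \<times> int) list" where
  "nbrs E v = map snd (filter (\<lambda>e. fst e = v) E) @ map fst (filter (\<lambda>e. snd e = v) E)"

text \<open>All three conditions can be checked by evaluation. Planarity is tested in both orders
  because the line through one of two disjoint segments may still cut the other.\<close>

locale straight_line_drawing =
  fixes E :: "((int \<times> int) \<times> (int \<times> int)) list"
  assumes nonloop: "list_all (\<lambda>e. fst e \<noteq> snd e) E"
    and cubic: "list_all (\<lambda>v. card (set (nbrs E v)) = 3) (map fst E @ map snd E)"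
    and planar: "list_all (\<lambda>e. list_all (\<lambda>f. e = f \<or> one_side e f \<or> one_side f e) E) E"
begin

definition V where "V = set (map fst E @ map snd E)"

lemma edgeD: "(a, b) \<in> set E \<Longrightarrow> a \<noteq> b \<and> a \<in> V \<and> b \<in> V"
  using nonloop rev_image_eqI[of "(a, b)" "set E" a fst] rev_image_eqI[of "(a, b)" "set E" b snd]
  by (auto simp: list_all_iff V_def)

lemma nbrs_iff: "y \<in> set (nbrs E v) \<longleftrightarrow> (v, y) \<in> set E \<or> (y, v) \<in> set E"
  by (cases v; cases y) (force simp: nbrs_def image_iff)

lemma trails_at:
  "{h \<in> seg ` set E. pt v \<in> endpoints h} = (\<lambda>y. seg (v, y)) ` set (nbrs E v)"
proof
  show "{h \<in> seg ` set E. pt v \<in> endpoints h} \<subseteq> (\<lambda>y. seg (v, y)) ` set (nbrs E v)"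
  proof clarify
    fix a b assume ab: "(a, b) \<in> set E" and "pt v \<in> endpoints (seg (a, b))"
    then have "v = a \<or> v = b"
      using edgeD endpoints_seg by auto
    then show "seg (a, b) \<in> (\<lambda>y. seg (v, y)) ` set (nbrs E v)"
      using ab seg_commute[of a b] by (auto simp only: nbrs_iff intro: image_eqI)
  qed
next
  show "(\<lambda>y. seg (v, y)) ` set (nbrs E v) \<subseteq> {h \<in> seg ` set E. pt v \<in> endpoints h}"
  proof clarify
    fix y assume "y \<in> set (nbrs E v)"
    then consider "(v, y) \<in> set E" | "(y, v) \<in> set E" by (auto simp: nbrs_iff)
    then show "seg (v, y) \<in> seg ` set E \<and> pt v \<in> endpoints (seg (v, y))"
    proof cases
      case 1
      then show ?thesis using edgeD[OF 1] endpoints_seg[of v y] by blast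
    next
      case 2
      then show ?thesis using edgeD[OF 2] endpoints_seg[of v y] seg_commute[of v y] by auto
    qed
  qed
qed

sublocale park_layout "pt ` V" "seg ` set E"
proof
  show "finite (seg ` set E)" by simp
next
  fix e assume "e \<in> seg ` set E"
  then obtain a b where "(a, b) \<in> set E" "e = closed_segment (pt a) (pt b)" by (auto simp: seg.simps)
  then show "\<exists>\<gamma>. arc \<gamma> \<and> path_image \<gamma> = e \<and> pathstart \<gamma> \<in> pt ` V \<and> pathfinish \<gamma> \<in> pt ` V"
    using edgeD by (intro exI[of _ "linepath (pt a) (pt b)"]) auto
next
  fix v assume "v \<in> pt ` V"
  then obtain u where u: "v = pt u" "u \<in> V" by auto
  \<comment> \<open>Distinct neighbours give distinct segments, so the number of trails at
    \<open>u\<close> is the number of its neighbours.\<close>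
  have "inj_on (\<lambda>y. seg (u, y)) (set (nbrs E u))"
  proof (rule inj_onI)
    fix y z assume yz: "y \<in> set (nbrs E u)" "z \<in> set (nbrs E u)" "seg (u, y) = seg (u, z)"
    have "u \<noteq> x" if "x \<in> set (nbrs E u)" for x
      using that edgeD[of u x] edgeD[of x u] by (auto simp only: nbrs_iff)
    then have "endpoints (seg (u, y)) = {pt u, pt y}" "endpoints (seg (u, z)) = {pt u, pt z}"
      using yz(1,2) by (simp_all add: endpoints_seg)
    then have "{pt u, pt y} = {pt u, pt z}" using yz(3) by simp
    then show "y = z" by (auto simp: doubleton_eq_iff)
  qed
  then have "card {e \<in> seg ` set E. pt u \<in> endpoints e} = card (set (nbrs E u))"
    by (simp only: trails_at card_image)
  then show "card {e \<in> seg ` set E. v \<in> endpoints e} = 3"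
    using cubic u by (auto simp: list_all_iff V_def)
next
  fix e f assume "e \<in> seg ` set E" "f \<in> seg ` set E" "e \<noteq> f"
  then obtain a b c d where ab: "(a, b) \<in> set E" "e = seg (a, b)"
    and cd: "(c, d) \<in> set E" "f = seg (c, d)"
    by (elim imageE) (metis surj_pair)
  have "one_side (a, b) (c, d) \<or> one_side (c, d) (a, b)"
    using planar ab cd \<open>e \<noteq> f\<close> unfolding list_all_iff by metis
  then have "e \<inter> f \<subseteq> {pt a, pt b} \<inter> {pt c, pt d}"
    using one_side_inter ab(2) cd(2) by (metis Int_commute)
  moreover have "endpoints e = {pt a, pt b}" "endpoints f = {pt c, pt d}" "{pt a, pt b} \<subseteq> pt ` V"
    using edgeD[OF ab(1)] edgeD[OF cd(1)] by (simp_all add: ab(2) cd(2) endpoints_seg)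
  ultimately show "e \<inter> f \<subseteq> pt ` V \<inter> endpoints e \<inter> endpoints f"
    by auto
next
  fix e f assume "e \<in> seg ` set E" "f \<in> seg ` set E" and eq: "endpoints e = endpoints f"
  then obtain a b c d where ab: "(a, b) \<in> set E" "e = seg (a, b)"
    and cd: "(c, d) \<in> set E" "f = seg (c, d)"
    by (elim imageE) (metis surj_pair)
  have "{pt a, pt b} = {pt c, pt d}"
    using eq edgeD[OF ab(1)] edgeD[OF cd(1)] by (simp add: ab(2) cd(2) endpoints_seg)
  then have "a = c \<and> b = d \<or> a = d \<and> b = c" by (simp add: doubleton_eq_iff)
  then show "e = f" by (metis ab(2) cd(2) seg_commute)
qed

lemma ccw_trails_seg:
  assumes "ccw_int v p q s"
  shows "ccw_trails (pt v) (seg (v, p)) (seg (v, q)) (seg (v, s))"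
  using assms by (simp add: seg.simps ccw_int_points ccw_trails_closed_segments)

section \<open>Walks checkable by evaluation\<close>

definition turn_int :: "bool \<Rightarrow> int \<times> int \<Rightarrow> int \<times> int \<Rightarrow> int \<times> int \<Rightarrow> bool" where
  "turn_int b u v w \<longleftrightarrow> list_ex (\<lambda>x. set (nbrs E v) = {u, w, x} \<and>
     (if b then ccw_int v u x w else ccw_int v u w x)) (nbrs E v)"

lemma turn_seg:
  assumes "turn_int b u v w"
  shows "turn b (seg ` set E) (pt v) (seg (u, v)) (seg (v, w))"
proof -
  obtain x where x: "set (nbrs E v) = {u, w, x}" "if b then ccw_int v u x w else ccw_int v u w x"
    using assms by (auto simp: turn_int_def list_ex_iff)
  have "{h \<in> seg ` set E. pt v \<in> endpoints h} = {seg (u, v), seg (v, w), seg (v, x)}"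
    unfolding trails_at x(1) using seg_commute[of u v] by simp
  then show ?thesis
    using x(2) ccw_trails_seg[of v u] seg_commute[of u v]
    unfolding turn_def turn_left_def turn_right_def by (cases b) metis+
qed

text \<open>The vertices alone fix the walk, as each trail is the segment between consecutive ones:
  \<open>length ps - 1\<close> trails with \<open>length ps - 2\<close> turns between them.\<close>

definition walk_int :: "(int \<times> int) list \<Rightarrow> bool" where
  "walk_int ps \<longleftrightarrow> 2 \<le> length ps \<and>
     list_all (\<lambda>i. ps ! Suc i \<in> set (nbrs E (ps ! i))) [0..<length ps - 1] \<and>
     list_all (\<lambda>i. turn_int (even i) (ps ! i) (ps ! Suc i) (ps ! Suc (Suc i))) [0..<length ps - 2] \<and>
     ps ! (length ps - 1) = ps ! 0 \<and>
     list_all (\<lambda>i. ps ! i \<noteq> ps ! 0) [1..<length ps - 1]"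

lemma park_walk_int:
  assumes "walk_int ps"
  shows "park_walk (pt ` V) (seg ` set E) (map pt ps)
    (map (\<lambda>i. seg (ps ! i, ps ! Suc i)) [0..<length ps - 1])"
proof -
  have len: "2 \<le> length ps" and last: "ps ! (length ps - Suc 0) = ps ! 0"
    using assms by (auto simp: walk_int_def)
  have edge: "(ps ! i, ps ! Suc i) \<in> set E \<or> (ps ! Suc i, ps ! i) \<in> set E" if "i < length ps - 1" for i
    using assms that by (simp add: walk_int_def list_all_iff nbrs_iff)
  have trail: "seg (ps ! i, ps ! Suc i) \<in> seg ` set E \<and>
      endpoints (seg (ps ! i, ps ! Suc i)) = {pt (ps ! i), pt (ps ! Suc i)}" if "i < length ps - 1" for i
    using edge[OF that]
  proof
    assume "(ps ! i, ps ! Suc i) \<in> set E"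
    then show ?thesis using edgeD endpoints_seg by blast
  next
    assume "(ps ! Suc i, ps ! i) \<in> set E"
    then show ?thesis using edgeD endpoints_seg seg_commute by (metis image_eqI)
  qed
  have start: "ps ! 0 \<in> V"
    using edge[of 0] len edgeD[of "ps ! 0" "ps ! Suc 0"] edgeD[of "ps ! Suc 0" "ps ! 0"] by auto
  have turns: "turn (even i) (seg ` set E) (pt (ps ! Suc i)) (seg (ps ! i, ps ! Suc i))
      (seg (ps ! Suc i, ps ! Suc (Suc i)))" if "Suc i < length ps - 1" for i
    using assms that turn_seg by (simp add: walk_int_def list_all_iff)
  have "ps ! i \<noteq> ps ! 0" if "0 < i" "i < length ps - 1" for i
    using assms that by (simp add: walk_int_def list_all_iff)
  \<comment> \<open>This form of the length removes truncated subtraction from the index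
    bounds.\<close>
  moreover obtain n where "length ps = Suc (Suc n)"
    using len by (metis add_2_eq_Suc le_Suc_ex)
  ultimately show ?thesis
    unfolding park_walk_def turn_def[symmetric]
    using last start trail turns by (simp del: upt_Suc)
qed

end

section \<open>A walk that attains three entries\<close>

text \<open>Found by computer search: vertex 5 is entered at steps 1, 10 and 15 of the walk.\<close>

definition example_vertex :: "nat \<Rightarrow> int \<times> int" where
  "example_vertex i =
     [(4, 0), (4, 1), (1, 1), (6, 2), (2, 2), (0, 4), (5, 5), (2, 4), (2, 6), (3, 5)] ! i"

definition example_edges :: "((int \<times> int) \<times> (int \<times> int)) list" where
  "example_edges = map (map_prod example_vertex example_vertex)
     [(0, 1), (0, 2), (0, 3), (1, 3), (1, 4), (2, 4), (2, 5), (3, 6), (4, 7), (5, 7), (5, 8),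
      (6, 8), (6, 9), (7, 9), (8, 9)]"

text \<open>The visits to vertex 5 lead from 2 to 8, from 7 to 8 and from 7 to 2, which uses all
  three corners there. The trails from 5 to 8 and from 7 to 5 are each walked twice in the same
  direction, but with opposite next turns.\<close>

definition example_walk :: "(int \<times> int) list" where
  "example_walk = map example_vertex [2, 5, 8, 9, 6, 3, 0, 1, 4, 7, 5, 8, 6, 9, 7, 5, 2]"

interpretation example: straight_line_drawing example_edges
proof
  show "list_all (\<lambda>e. fst e \<noteq> snd e) example_edges"
    by code_simp
  show "list_all (\<lambda>v. card (set (nbrs example_edges v)) = 3)
      (map fst example_edges @ map snd example_edges)"
    by code_simp
  show "list_all (\<lambda>e. list_all (\<lambda>f. e = f \<or> one_side e f \<or> one_side f e) example_edges)
      example_edges"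
    by code_simp
qed

lemma walk_int_example: "example.walk_int example_walk"
  unfolding example.walk_int_def example.turn_int_def by code_simp

lemma example_entries: "entries (map pt example_walk) (pt (example_vertex 5)) = 3"
proof -
  \<comment> \<open>Injectivity of \<open>pt\<close> moves the count to integer pairs, where it can
    be evaluated.\<close>
  have "count_list (map pt xs) (pt x) = count_list xs x" for xs x
    by (induction xs) auto
  then have "entries (map pt example_walk) (pt (example_vertex 5)) =
      count_list (tl example_walk) (example_vertex 5)"
    by (simp add: entries_def map_tl[symmetric])
  also have "\<dots> = 3" by code_simp
  finally show ?thesis .
qed

theorem mainTheorem2:
  "(\<forall>J T vs es. \<forall>v\<in>J. park_layout J T \<and> park_walk J T vs es \<longrightarrow> entries vs v \<le> 3) \<and>
   (\<exists>J T vs es. \<exists>v\<in>J. park_layout J T \<and> park_walk J T vs es \<and> entries vs v = 3)"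
proof
  show "\<forall>J T vs es. \<forall>v\<in>J. park_layout J T \<and> park_walk J T vs es \<longrightarrow> entries vs v \<le> 3"
  proof (intro allI ballI impI)
    fix J T vs es v
    assume "v \<in> J" "park_layout J T \<and> park_walk J T vs es"
    then interpret park_visit J T vs es
      by (simp add: park_visit_def park_visit_axioms_def)
    show "entries vs v \<le> 3" using \<open>v \<in> J\<close> by (rule entries_le)
  qed
  show "\<exists>J T vs es. \<exists>v\<in>J. park_layout J T \<and> park_walk J T vs es \<and> entries vs v = 3"
  proof (intro exI bexI conjI)
    show "park_layout (pt ` example.V) (seg ` set example_edges)"
      by (rule example.park_layout_axioms)
    show "park_walk (pt ` example.V) (seg ` set example_edges) (map pt example_walk)
        (map (\<lambda>i. seg (example_walk ! i, example_walk ! Suc i)) [0..<length example_walk - 1])"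
      by (rule example.park_walk_int[OF walk_int_example])
    show "entries (map pt example_walk) (pt (example_vertex 5)) = 3"
      by (rule example_entries)
    have "(example_vertex 5, example_vertex 7) \<in> set example_edges" by (simp add: example_edges_def)
    then show "pt (example_vertex 5) \<in> pt ` example.V" using example.edgeD by blast
  qed
qed

end
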